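(* Let $(X,d)$ be a complete (proper geodesic) Busemann concave metric space and assume that $X$ contains a line $\gamma:\mathbb{R}\to X$. Then through every $x\in X$ there is a unique line $\eta$ parallel to $\gamma$ (unique up to shifting the parameter), and there is a metric space $X'$ such that $(X,d)$ is bi-Lipschitz homeomorphic to $(X'\times\mathbb{R},\tilde d)$, where $\tilde d$ is a product metric.
   Context: A metric space is proper if closed bounded subsets are compact. A geodesic from $x$ to $y$ is a map $\gamma:[0,1]\to X$ with $\gamma(0)=x$, $\gamma(1)=y$ and $d(\gamma(t),\gamma(s))=|t-s|\,d(x,y)$; $X$ is geodesic if any two points are joined by a geodesic. A geodesic space $(X,d)$ is Busemann concave if for all $x,y_1,y_2\in X$ and all geodesics $\gamma_i$ from $x$ to $y_i$ ($i=1,2$) the function $t\mapsto d(\gamma_1(t),\gamma_2(t))$ is concave on $[0,1]$. A ray (resp. line) is an isometric embedding $[0,\infty)\to X$ (resp. $\mathbb{R}\to X$). A ray $\eta$ is asymptotic to a ray $\gamma$ if there are $t_n\to\infty$ and unit speed geodesics $\eta_n:[0,d(\eta(0),\gamma(t_n))]\to X$ from $\eta(0)$ to $\gamma(t_n)$ converging to $\eta$ uniformly on compact subsets. For a line $\gamma$ put $\gamma^{\pm}(t)=\gamma(\pm t)$, $t\ge 0$. A line $\eta$ is bi-asymptotic to $\gamma$ if $\eta^{+}$ is asymptotic to $\gamma^{+}$ and $\eta^-$ is asymptotic to $\gamma^-$; $\eta$ is parallel to $\gamma$ if for every $s\in\mathbb{R}$ the shifted line $t\mapsto\eta(t+s)$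 is bi-asymptotic to $\gamma$. A product metric on $X'\times\mathbb{R}$, for a metric space $(X',d')$, is a metric of the form $\tilde d((x,t),(y,s))=F(d'(x,y),|t-s|)$ with $F$ a norm on $\mathbb{R}^2$; for instance $\tilde d((x,t),(y,s))=d'(x,y)+|t-s|$. *)

theory Defs
  imports "HOL-Analysis.Analysis"
begin

text \<open>The ambient space is a type of class \<open>metric_space\<close>. Geodesics, rays and lines are total
  functions on the reals; rays and geodesics are constrained only on their parameter interval.\<close>

definition isometric_on :: "real set \<Rightarrow> (real \<Rightarrow> 'a::metric_space) \<Rightarrow> bool" where
  "isometric_on I c \<longleftrightarrow> (\<forall>s\<in>I. \<forall>t\<in>I. dist (c s) (c t) = \<bar>s - t\<bar>)"

definition is_geodesic :: "(real \<Rightarrow> 'a::metric_space) \<Rightarrow> 'a \<Rightarrow> 'a \<Rightarrow> bool" where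
  "is_geodesic c x y \<longleftrightarrow> c 0 = x \<and> c 1 = y \<and>
     (\<forall>t\<in>{0..1}. \<forall>s\<in>{0..1}. dist (c t) (c s) = \<bar>t - s\<bar> * dist x y)"

definition unit_speed_geodesic :: "(real \<Rightarrow> 'a::metric_space) \<Rightarrow> 'a \<Rightarrow> 'a \<Rightarrow> bool" where
  "unit_speed_geodesic c x y \<longleftrightarrow>
     isometric_on {0..dist x y} c \<and> c 0 = x \<and> c (dist x y) = y"

definition proper_space :: "'a::metric_space itself \<Rightarrow> bool" where
  "proper_space _ \<longleftrightarrow> (\<forall>S :: 'a set. closed S \<and> bounded S \<longrightarrow> compact S)"

definition geodesic_space :: "'a::metric_space itself \<Rightarrow> bool" where
  "geodesic_space _ \<longleftrightarrow> (\<forall>x y :: 'a. \<exists>c. is_geodesic c x y)"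

definition busemann_concave :: "'a::metric_space itself \<Rightarrow> bool" where
  "busemann_concave _ \<longleftrightarrow> geodesic_space TYPE('a) \<and>
     (\<forall>(x :: 'a) y1 y2 c1 c2. is_geodesic c1 x y1 \<and> is_geodesic c2 x y2 \<longrightarrow>
        concave_on {0..1} (\<lambda>t. dist (c1 t) (c2 t)))"

definition is_ray :: "(real \<Rightarrow> 'a::metric_space) \<Rightarrow> bool" where
  "is_ray c \<longleftrightarrow> isometric_on {0..} c"

definition is_line :: "(real \<Rightarrow> 'a::metric_space) \<Rightarrow> bool" where
  "is_line c \<longleftrightarrow> isometric_on UNIV c"

text \<open>Each compact \<open>K\<close> below eventually lies in the domains \<open>{0..dist (\<eta> 0) (\<gamma> (t n))}\<close> of
  the approximating geodesics, since \<open>t n\<close> tends to infinity and \<open>\<gamma>\<close> is a ray.\<close>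

definition asymptotic_ray :: "(real \<Rightarrow> 'a::metric_space) \<Rightarrow> (real \<Rightarrow> 'a) \<Rightarrow> bool" where
  "asymptotic_ray \<eta> \<gamma> \<longleftrightarrow> is_ray \<eta> \<and> is_ray \<gamma> \<and>
     (\<exists>t :: nat \<Rightarrow> real. \<exists>\<eta>n :: nat \<Rightarrow> real \<Rightarrow> 'a.
        (\<forall>n. 0 \<le> t n) \<and> filterlim t at_top sequentially \<and>
        (\<forall>n. unit_speed_geodesic (\<eta>n n) (\<eta> 0) (\<gamma> (t n))) \<and>
        (\<forall>K. compact K \<and> K \<subseteq> {0..} \<longrightarrow> uniform_limit K \<eta>n \<eta> sequentially))"

definition bi_asymptotic :: "(real \<Rightarrow> 'a::metric_space) \<Rightarrow> (real \<Rightarrow> 'a) \<Rightarrow> bool" where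
  "bi_asymptotic \<eta> \<gamma> \<longleftrightarrow> is_line \<eta> \<and> is_line \<gamma> \<and> asymptotic_ray \<eta> \<gamma> \<and>
     asymptotic_ray (\<lambda>t. \<eta> (- t)) (\<lambda>t. \<gamma> (- t))"

definition parallel_line :: "(real \<Rightarrow> 'a::metric_space) \<Rightarrow> (real \<Rightarrow> 'a) \<Rightarrow> bool" where
  "parallel_line \<eta> \<gamma> \<longleftrightarrow> (\<forall>s. bi_asymptotic (\<lambda>t. \<eta> (t + s)) \<gamma>)"

definition is_norm_R2 :: "(real \<times> real \<Rightarrow> real) \<Rightarrow> bool" where
  "is_norm_R2 F \<longleftrightarrow> (\<forall>v. 0 \<le> F v) \<and> (\<forall>v. F v = 0 \<longleftrightarrow> v = 0) \<and>
     (\<forall>a v. F (a *\<^sub>R v) = \<bar>a\<bar> * F v) \<and> (\<forall>v w. F (v + w) \<le> F v + F w)"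

text \<open>For a general norm \<open>F\<close> the formula need not satisfy the triangle inequality; that it does is
  part of \<open>D\<close> having type \<open>metric\<close>.\<close>

definition is_product_metric :: "'b metric \<Rightarrow> ('b \<times> real) metric \<Rightarrow> bool" where
  "is_product_metric X' D \<longleftrightarrow> mspace D = mspace X' \<times> UNIV \<and>
     (\<exists>F. is_norm_R2 F \<and>
        (\<forall>x\<in>mspace X'. \<forall>y\<in>mspace X'. \<forall>t s.
           mdist D (x, t) (y, s) = F (mdist X' x y, \<bar>t - s\<bar>)))"

definition bi_lipschitz_homeomorphic :: "'a metric \<Rightarrow> 'b metric \<Rightarrow> bool" where
  "bi_lipschitz_homeomorphic X Y \<longleftrightarrow>
     (\<exists>f g. Lipschitz_continuous_map X Y f \<and> Lipschitz_continuous_map Y X g \<and>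
        (\<forall>x\<in>mspace X. g (f x) = x) \<and> (\<forall>y\<in>mspace Y. f (g y) = y))"

end

theory Submission
  imports Defs
begin

text \<open>Concavity of \<open>d(\<gamma>\<^sub>1(t), \<gamma>\<^sub>2(t))\<close> forbids branching. Applied at \<open>x\<close> to geodesics
  ending at \<open>\<gamma>(n)\<close> and \<open>\<gamma>(- n)\<close>, it shows that the limiting rays lie at distance at least \<open>2 s\<close>
  at time \<open>s\<close>, so that together they form a line. The Busemann function of \<open>\<gamma>\<close> grows at unit
  speed along asymptotic rays, hence an asymptotic ray followed by another one is still a ray, and
  non-branching makes asymptotic rays unique at interior points; since every point is interior to
  a line of this kind, asymptotic rays are unique everywhere. The lines through the points of \<open>X\<close>
  are therefore the orbits of a flow. Concavity at \<open>\<gamma>(n)\<close> and at \<open>\<gamma>(- n)\<close> makes the distance of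
  two flowing points both nondecreasing and nonincreasing, so the flow is isometric. Flowing to
  the zero level \<open>X'\<close> of the Busemann function gives the bi-Lipschitz map onto \<open>X' \<times> \<real>\<close>.\<close>

subsection \<open>Geodesics and non-branching\<close>

lemma isometric_onD:
  "isometric_on I c \<Longrightarrow> s \<in> I \<Longrightarrow> t \<in> I \<Longrightarrow> dist (c s) (c t) = \<bar>s - t\<bar>"
  by (simp add: isometric_on_def)

lemma isometric_on_subset: "isometric_on J c \<Longrightarrow> I \<subseteq> J \<Longrightarrow> isometric_on I c"
  by (auto simp: isometric_on_def)

lemma is_geodesic_rescale:
  assumes "isometric_on {0..R} c" "0 \<le> R"
  shows "is_geodesic (\<lambda>t. c (t * R)) (c 0) (c R)"
proof -
  have "dist (c (t * R)) (c (s * R)) = \<bar>t - s\<bar> * dist (c 0) (c R)"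
    if "t \<in> {0..1}" "s \<in> {0..1}" for t s
  proof -
    have "t * R \<in> {0..R}" "s * R \<in> {0..R}"
      using that assms(2) by (auto simp: mult_left_le_one_le)
    then have "dist (c (t * R)) (c (s * R)) = \<bar>t - s\<bar> * R"
      using assms by (simp add: isometric_onD abs_mult flip: left_diff_distrib)
    moreover have "dist (c 0) (c R) = R"
      using assms by (simp add: isometric_onD)
    ultimately show ?thesis by simp
  qed
  then show ?thesis by (simp add: is_geodesic_def)
qed

lemma is_geodesic_reverse: "is_geodesic c x y \<Longrightarrow> is_geodesic (\<lambda>t. c (1 - t)) y x"
  by (auto simp: is_geodesic_def dist_commute abs_minus_commute)

lemma unit_speed_geodesic_rescale:
  "unit_speed_geodesic c x y \<Longrightarrow> is_geodesic (\<lambda>t. c (t * dist x y)) x y"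
  using is_geodesic_rescale[of "dist x y" c] by (simp add: unit_speed_geodesic_def)

lemma unit_speed_geodesic_exists:
  fixes x y :: "'a::metric_space"
  assumes "geodesic_space TYPE('a)"
  obtains c where "unit_speed_geodesic c x y"
proof -
  obtain c where c: "is_geodesic c x y"
    using assms by (auto simp: geodesic_space_def)
  show ?thesis
  proof (cases "x = y")
    case True
    then have "unit_speed_geodesic (\<lambda>_. x) x y"
      by (auto simp: unit_speed_geodesic_def isometric_on_def)
    then show ?thesis by (rule that)
  next
    case False
    have "unit_speed_geodesic (\<lambda>r. c (r / dist x y)) x y"
      unfolding unit_speed_geodesic_def isometric_on_def
    proof (intro conjI ballI)
      fix s t assume "s \<in> {0..dist x y}" "t \<in> {0..dist x y}"
      then have "dist (c (s / dist x y)) (c (t / dist x y))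
          = \<bar>s / dist x y - t / dist x y\<bar> * dist x y"
        using c by (auto simp: is_geodesic_def divide_simps)
      also have "\<dots> = \<bar>s - t\<bar>"
        using False by (simp flip: diff_divide_distrib)
      finally show "dist (c (s / dist x y)) (c (t / dist x y)) = \<bar>s - t\<bar>" .
    qed (use c False in \<open>auto simp: is_geodesic_def\<close>)
    then show ?thesis by (rule that)
  qed
qed

section \<open>Concavity inequalities for geodesics issuing from one point\<close>

lemma busemann_concave_dist_ge:
  fixes x :: "'a::metric_space"
  assumes "busemann_concave TYPE('a)" "is_geodesic c1 x y1" "is_geodesic c2 x y2"
    and "0 \<le> a" "a \<le> 1"
  shows "a * dist y1 y2 \<le> dist (c1 a) (c2 a)"
proof -
  have "concave_on {0..1} (\<lambda>t. dist (c1 t) (c2 t))"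
    using assms(1-3) unfolding busemann_concave_def by blast
  from concave_onD[OF this \<open>0 \<le> a\<close> \<open>a \<le> 1\<close>, of 0 1] show ?thesis
    using assms(2,3) by (simp add: is_geodesic_def)
qed

text \<open>This is concavity at \<open>s\<close>, a convex combination of \<open>r\<close> and
  \<open>R\<close>, for unit speed curves. Clearing the denominator \<open>R - r\<close> lets the
  degenerate case \<open>r = R\<close> be included.\<close>

lemma busemann_concave_three_point:
  fixes c1 c2 :: "real \<Rightarrow> 'a::metric_space"
  assumes "busemann_concave TYPE('a)" "isometric_on {0..R} c1" "isometric_on {0..R} c2"
    and "c1 0 = c2 0" and rs: "0 \<le> r" "r \<le> s" "s \<le> R"
  shows "(R - s) * dist (c1 r) (c2 r) + (s - r) * dist (c1 R) (c2 R)
      \<le> (R - r) * dist (c1 s) (c2 s)"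
proof (cases "r = R")
  case True
  with rs show ?thesis by simp
next
  case False
  with rs have R: "0 < R" "r < R" by auto
  \<comment> \<open>The weight solves (1 - a) r + a R = s.\<close>
  define a where "a = (s - r) / (R - r)"
  have a: "0 \<le> a" "a \<le> 1" "(R - r) * a = s - r"
    using rs R by (auto simp: a_def)
  then have a': "(R - r) * (1 - a) = R - s"
    by (simp add: right_diff_distrib)
  have "concave_on {0..1} (\<lambda>t. dist (c1 (t * R)) (c2 (t * R)))"
    using assms(1) is_geodesic_rescale[OF assms(2)] is_geodesic_rescale[OF assms(3)] R assms(4)
    unfolding busemann_concave_def by (metis less_eq_real_def)
  from concave_onD[OF this, of a "r / R" 1]
  have *: "(1 - a) * dist (c1 r) (c2 r) + a * dist (c1 R) (c2 R)
      \<le> dist (c1 (((1 - a) * (r / R) + a) * R)) (c2 (((1 - a) * (r / R) + a) * R))"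
    using rs R a by simp
  have "((1 - a) * (r / R) + a) * R = (1 - a) * r + a * R"
    using R by (simp add: distrib_right)
  also have "\<dots> = r + (R - r) * a"
    by (simp add: algebra_simps)
  also have "\<dots> = s"
    using a by simp
  finally have "(1 - a) * dist (c1 r) (c2 r) + a * dist (c1 R) (c2 R) \<le> dist (c1 s) (c2 s)"
    using * by simp
  then have "(R - r) * ((1 - a) * dist (c1 r) (c2 r) + a * dist (c1 R) (c2 R))
      \<le> (R - r) * dist (c1 s) (c2 s)"
    using R by (intro mult_left_mono) auto
  then show ?thesis
    by (simp add: distrib_left a a' flip: mult.assoc)
qed

text \<open>For \<open>r \<le> 1\<close>, concavity on \<open>r\<close>, 1, \<open>R\<close> is used
  with the nonnegative term at \<open>R\<close> dropped; \<open>2 \<le> R\<close> makes the factor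
  \<open>R - 1\<close> at least 1. For \<open>r > 1\<close> the distance vanishes at 0, so its value
  at 1 is at least a fraction 1/r of its value at \<open>r\<close>.\<close>

lemma busemann_concave_dist_le_at_1:
  fixes c1 c2 :: "real \<Rightarrow> 'a::metric_space"
  assumes "busemann_concave TYPE('a)" "isometric_on {0..R} c1" "isometric_on {0..R} c2"
    and "c1 0 = c2 0" and r: "0 \<le> r" "r \<le> R" and "2 \<le> R"
  shows "dist (c1 r) (c2 r) \<le> R * dist (c1 1) (c2 1)"
proof (cases "r \<le> 1")
  case True
  have "(R - 1) * dist (c1 r) (c2 r) \<le> (R - r) * dist (c1 1) (c2 1)"
    using busemann_concave_three_point[OF assms(1-4) r(1) True] assms(7) True
    by (smt (verit) mult_nonneg_nonneg zero_le_dist)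
  moreover have "1 * dist (c1 r) (c2 r) \<le> (R - 1) * dist (c1 r) (c2 r)"
    using assms(7) by (intro mult_right_mono) auto
  moreover have "(R - r) * dist (c1 1) (c2 1) \<le> R * dist (c1 1) (c2 1)"
    using r by (intro mult_right_mono) auto
  ultimately show ?thesis by linarith
next
  case False
  have "isometric_on {0..r} c1" "isometric_on {0..r} c2"
    using assms(2,3) r by (auto intro: isometric_on_subset)
  from busemann_concave_three_point[OF assms(1) this assms(4), of 0 1] False
  have "dist (c1 r) (c2 r) \<le> r * dist (c1 1) (c2 1)"
    using assms(4) by simp
  also have "\<dots> \<le> R * dist (c1 1) (c2 1)"
    using r by (intro mult_right_mono) auto
  finally show ?thesis .
qed

text \<open>A nonnegative concave function on [0, r] that vanishes at 0 and at the interior point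
  \<open>s\<close> must vanish at \<open>r\<close>.\<close>

lemma rays_nonbranching:
  fixes c1 c2 :: "real \<Rightarrow> 'a::metric_space"
  assumes "busemann_concave TYPE('a)" "is_ray c1" "is_ray c2"
    and agree: "\<And>r. 0 \<le> r \<Longrightarrow> r \<le> s \<Longrightarrow> c1 r = c2 r" and "0 < s" "0 \<le> r"
  shows "c1 r = c2 r"
proof (cases "r \<le> s")
  case True
  then show ?thesis using agree \<open>0 \<le> r\<close> by simp
next
  case False
  have "isometric_on {0..r} c1" "isometric_on {0..r} c2"
    using assms(2,3) by (auto simp: is_ray_def intro: isometric_on_subset)
  from busemann_concave_three_point[OF assms(1) this, of 0 s] False \<open>0 < s\<close> agree[of 0] agree[of s]
  show ?thesis by (simp add: mult_le_0_iff)
qed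

lemma lines_nonbranching:
  fixes c1 c2 :: "real \<Rightarrow> 'a::metric_space"
  assumes "busemann_concave TYPE('a)" "is_line c1" "is_line c2"
    and agree: "\<And>r. r \<le> 0 \<Longrightarrow> c1 r = c2 r"
  shows "c1 r = c2 r"
proof (cases "r \<le> 0")
  case False
  \<comment> \<open>Started at parameter -1, the two lines become rays that agree on [0, 1], an
    initial segment of positive length.\<close>
  have "is_ray (\<lambda>t. c1 (t - 1))" "is_ray (\<lambda>t. c2 (t - 1))"
    using assms(2,3) by (auto simp: is_ray_def is_line_def isometric_on_def)
  from rays_nonbranching[OF assms(1) this, of 1 "r + 1"] False agree show ?thesis
    by simp
qed (use agree in simp)

lemma is_line_shift: "is_line c \<Longrightarrow> is_line (\<lambda>t. c (t + s))"
  by (simp add: is_line_def isometric_on_def)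

lemma is_line_reverse: "is_line c \<Longrightarrow> is_line (\<lambda>t. c (- t))"
  by (auto simp: is_line_def isometric_on_def abs_minus_commute)

lemma is_line_imp_is_ray: "is_line c \<Longrightarrow> is_ray c"
  by (simp add: is_line_def is_ray_def isometric_on_def)

text \<open>The distances are prescribed only eventually because the approximating geodesics have
  growing domains.\<close>

lemma isometric_on_limit:
  assumes "\<And>r. r \<in> I \<Longrightarrow> (\<lambda>n. \<sigma> n r) \<longlonglongrightarrow> \<rho> r"
    and "\<And>r s. r \<in> I \<Longrightarrow> s \<in> I \<Longrightarrow> \<forall>\<^sub>F n in sequentially. dist (\<sigma> n r) (\<sigma> n s) = \<bar>r - s\<bar>"
  shows "isometric_on I \<rho>"
  unfolding isometric_on_def
proof (intro ballI)
  fix r s assume rs: "r \<in> I" "s \<in> I"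
  have "(\<lambda>n. dist (\<sigma> n r) (\<sigma> n s)) \<longlonglongrightarrow> dist (\<rho> r) (\<rho> s)"
    using assms(1) rs by (intro tendsto_dist)
  moreover have "(\<lambda>n. dist (\<sigma> n r) (\<sigma> n s)) \<longlonglongrightarrow> \<bar>r - s\<bar>"
    using assms(2)[OF rs] by (rule tendsto_eventually)
  ultimately show "dist (\<rho> r) (\<rho> s) = \<bar>r - s\<bar>"
    by (rule LIMSEQ_unique)
qed

subsection \<open>Asymptotic rays\<close>

text \<open>Exposing the parameters \<open>t\<close> and the geodesics \<open>\<sigma>\<close>
  allows two rays to be compared along the same sequence of target points.\<close>

definition asymptotic_along ::
    "(real \<Rightarrow> 'a::metric_space) \<Rightarrow> (nat \<Rightarrow> real) \<Rightarrow> (nat \<Rightarrow> real \<Rightarrow> 'a) \<Rightarrow> (real \<Rightarrow> 'a) \<Rightarrow> bool" where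
  "asymptotic_along \<gamma> t \<sigma> \<rho> \<longleftrightarrow> is_ray \<rho> \<and> (\<forall>n. 0 \<le> t n) \<and> filterlim t at_top sequentially \<and>
     (\<forall>n. unit_speed_geodesic (\<sigma> n) (\<rho> 0) (\<gamma> (t n))) \<and>
     (\<forall>K. compact K \<and> K \<subseteq> {0..} \<longrightarrow> uniform_limit K \<sigma> \<rho> sequentially)"

lemma asymptotic_ray_iff:
  "asymptotic_ray \<rho> \<gamma> \<longleftrightarrow> is_ray \<gamma> \<and> (\<exists>t \<sigma>. asymptotic_along \<gamma> t \<sigma> \<rho>)"
  by (auto simp: asymptotic_ray_def asymptotic_along_def)

text \<open>Serves to bring two rays, found by successive extractions, to common parameters.\<close>

lemma asymptotic_along_subseq:
  assumes "asymptotic_along \<gamma> t \<sigma> \<rho>" "strict_mono r"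
  shows "asymptotic_along \<gamma> (t \<circ> r) (\<sigma> \<circ> r) \<rho>"
proof -
  have r: "filterlim r sequentially sequentially"
    using assms(2) by (rule filterlim_subseq)
  have "uniform_limit K (\<sigma> \<circ> r) \<rho> sequentially" if "compact K" "K \<subseteq> {0..}" for K
  proof -
    have "uniform_limit K \<sigma> \<rho> sequentially"
      using assms(1) that by (simp add: asymptotic_along_def)
    from filterlim_compose[OF this r] show ?thesis
      by (simp add: comp_def)
  qed
  moreover have "filterlim (t \<circ> r) at_top sequentially"
    using assms(1) r unfolding comp_def asymptotic_along_def by (blast intro: filterlim_compose)
  ultimately show ?thesis
    using assms(1) by (simp add: asymptotic_along_def)
qed

lemma asymptotic_ray_cong:
  assumes "asymptotic_ray \<rho> \<gamma>" "\<And>r. 0 \<le> r \<Longrightarrow> \<rho> r = \<rho>' r"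
  shows "asymptotic_ray \<rho>' \<gamma>"
proof -
  obtain t \<sigma> where *: "is_ray \<gamma>" "asymptotic_along \<gamma> t \<sigma> \<rho>"
    using assms(1) by (auto simp: asymptotic_ray_iff)
  have "uniform_limit K \<sigma> \<rho>' sequentially" if "compact K" "K \<subseteq> {0..}" for K
  proof -
    have "uniform_limit K \<sigma> \<rho> sequentially"
      using *(2) that by (simp add: asymptotic_along_def)
    moreover have "\<rho> r = \<rho>' r" if "r \<in> K" for r
      using assms(2) that \<open>K \<subseteq> {0..}\<close> by auto
    ultimately show ?thesis
      by (simp add: uniform_limit_iff)
  qed
  moreover have "is_ray \<rho>'"
    using *(2) assms(2) by (simp add: asymptotic_along_def is_ray_def isometric_on_def)
  ultimately have "asymptotic_along \<gamma> t \<sigma> \<rho>'"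
    using *(2) assms(2)[of 0] by (simp add: asymptotic_along_def)
  then show ?thesis
    using *(1) by (auto simp: asymptotic_ray_iff)
qed

lemma ray_dist_bounds:
  assumes "is_ray \<gamma>" "0 \<le> t"
  shows "\<bar>dist x (\<gamma> t) - t\<bar> \<le> dist x (\<gamma> 0)"
proof -
  have "dist (\<gamma> 0) (\<gamma> t) = t"
    using assms by (simp add: is_ray_def isometric_on_def)
  then show ?thesis
    using dist_triangle[of x "\<gamma> t" "\<gamma> 0"] dist_triangle3[of "\<gamma> 0" "\<gamma> t" x] by linarith
qed

lemma ray_dist_at_top:
  assumes "is_ray \<gamma>" "\<And>n. 0 \<le> t n" "filterlim t at_top sequentially"
  shows "filterlim (\<lambda>n. dist x (\<gamma> (t n))) at_top sequentially"
proof (rule filterlim_at_top_mono)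
  show "filterlim (\<lambda>n. - dist x (\<gamma> 0) + t n) at_top sequentially"
    by (rule filterlim_tendsto_add_at_top[OF tendsto_const assms(3)])
  show "\<forall>\<^sub>F n in sequentially. - dist x (\<gamma> 0) + t n \<le> dist x (\<gamma> (t n))"
    using ray_dist_bounds[OF assms(1,2)] by (intro always_eventually allI) (smt (verit))
qed

text \<open>The term is the arc length at affine parameter \<open>s / t n\<close> on a geodesic from
  \<open>x\<close> to \<open>\<gamma> (t n)\<close>. Since \<open>dist x (\<gamma> (t n))\<close>
  differs from \<open>t n\<close> by a bounded amount, affine and arc length parameters match in the
  limit.\<close>

lemma ray_dist_ratio:
  assumes "is_ray \<gamma>" "\<And>n. 0 \<le> t n" "filterlim t at_top sequentially"
  shows "(\<lambda>n. s / t n * dist x (\<gamma> (t n))) \<longlonglongrightarrow> s"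
proof -
  have "(\<lambda>n. dist x (\<gamma> (t n)) / t n - 1) \<longlonglongrightarrow> 0"
  proof (rule Lim_null_comparison)
    show "(\<lambda>n. dist x (\<gamma> 0) / t n) \<longlonglongrightarrow> 0"
      using assms(3) by (intro tendsto_divide_0[OF tendsto_const] filterlim_at_top_imp_at_infinity)
    have "\<forall>\<^sub>F n in sequentially. 0 < t n"
      using assms(3) by (simp add: filterlim_at_top_dense)
    then show "\<forall>\<^sub>F n in sequentially. norm (dist x (\<gamma> (t n)) / t n - 1) \<le> dist x (\<gamma> 0) / t n"
    proof eventually_elim
      case (elim n)
      then have "dist x (\<gamma> (t n)) / t n - 1 = (dist x (\<gamma> (t n)) - t n) / t n"
        by (simp add: field_simps)
      then show ?case
        using elim ray_dist_bounds[OF assms(1,2), of x n] by (simp add: divide_right_mono)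
    qed
  qed
  then have "(\<lambda>n. s * (dist x (\<gamma> (t n)) / t n - 1) + s) \<longlonglongrightarrow> s * 0 + s"
    by (intro tendsto_intros)
  then show ?thesis by (simp add: algebra_simps)
qed

text \<open>Evaluation at moving parameters: uniform convergence on [0, s + 1] handles the curves,
  and the isometry \<open>\<rho>\<close> handles the parameters.\<close>

lemma asymptotic_along_tendsto:
  assumes "asymptotic_along \<gamma> t \<sigma> \<rho>" "u \<longlonglongrightarrow> s" "\<And>n. 0 \<le> u n"
  shows "(\<lambda>n. \<sigma> n (u n)) \<longlonglongrightarrow> \<rho> s"
proof (rule tendstoI)
  fix e :: real assume "0 < e"
  have "0 \<le> s"
    using assms(3) by (intro LIMSEQ_le_const[OF assms(2)]) auto
  have "uniform_limit {0..s+1} \<sigma> \<rho> sequentially"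
    using assms(1) by (simp add: asymptotic_along_def)
  then have "\<forall>\<^sub>F n in sequentially. \<forall>r\<in>{0..s+1}. dist (\<sigma> n r) (\<rho> r) < e/2"
    using \<open>0 < e\<close> by (intro uniform_limitD) auto
  moreover have "\<forall>\<^sub>F n in sequentially. dist (u n) s < min 1 (e/2)"
    using \<open>0 < e\<close> assms(2) by (intro tendstoD) auto
  ultimately show "\<forall>\<^sub>F n in sequentially. dist (\<sigma> n (u n)) (\<rho> s) < e"
  proof eventually_elim
    case (elim n)
    then have "u n \<in> {0..s+1}"
      using assms(3)[of n] by (auto simp: dist_real_def)
    with elim have "dist (\<sigma> n (u n)) (\<rho> (u n)) < e/2" by blast
    moreover have "dist (\<rho> (u n)) (\<rho> s) < e/2"
      using assms(1,3) \<open>0 \<le> s\<close> elim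
      by (simp add: asymptotic_along_def is_ray_def isometric_on_def dist_real_def)
    ultimately show ?case
      using dist_triangle[of "\<sigma> n (u n)" "\<rho> s" "\<rho> (u n)"] by linarith
  qed
qed

text \<open>By \<open>busemann_concave_dist_le_at_1\<close>, convergence of geodesics with a common origin at the
  single parameter 1 already forces locally uniform convergence.\<close>

lemma asymptotic_along_exists:
  fixes \<gamma> :: "real \<Rightarrow> 'a::metric_space"
  assumes "complete (UNIV :: 'a set)" "proper_space TYPE('a)" and bc: "busemann_concave TYPE('a)"
    and "is_ray \<gamma>" and t: "\<And>n. 0 \<le> t n" "filterlim t at_top sequentially"
    and \<sigma>: "\<And>n. unit_speed_geodesic (\<sigma> n) x (\<gamma> (t n))"
  obtains r \<rho> where "strict_mono r" "\<rho> 0 = x" "asymptotic_along \<gamma> (t \<circ> r) (\<sigma> \<circ> r) \<rho>"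
proof -
  define l where "l n = dist x (\<gamma> (t n))" for n
  have l: "filterlim l at_top sequentially"
    unfolding l_def by (rule ray_dist_at_top[OF \<open>is_ray \<gamma>\<close> t])
  have \<sigma>0: "\<sigma> n 0 = x" and iso: "isometric_on {0..l n} (\<sigma> n)" for n
    using \<sigma>[of n] by (simp_all add: unit_speed_geodesic_def l_def)
  \<comment> \<open>The default \<open>x\<close> covers the finitely many geodesics too short to
    reach parameter 1, so that the whole sequence stays in a compact ball.\<close>
  define w where "w n = (if 1 \<le> l n then \<sigma> n 1 else x)" for n
  have "dist x (\<sigma> n 1) \<le> 1" if "1 \<le> l n" for n
    using isometric_onD[OF iso, of 0 n 1] that \<sigma>0[of n] by simp
  then have "\<forall>n. w n \<in> cball x 1"
    by (simp add: w_def)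
  moreover have "seq_compact (cball x 1)"
    using assms(2) by (auto simp: proper_space_def intro: compact_imp_seq_compact)
  ultimately obtain p r where r: "strict_mono r" and p: "(w \<circ> r) \<longlonglongrightarrow> p"
    by (metis seq_compactE)
  have lr: "filterlim (l \<circ> r) at_top sequentially"
    using filterlim_compose[OF l filterlim_subseq[OF r]] by (simp add: comp_def)
  then have ev: "\<forall>\<^sub>F n in sequentially. R \<le> l (r n)" for R
    by (simp add: filterlim_at_top)
  define \<tau> where "\<tau> = \<sigma> \<circ> r"
  have \<tau>1: "(\<lambda>n. \<tau> n 1) \<longlonglongrightarrow> p"
    using ev[of 1] by (intro Lim_transform_eventually[OF p]) (auto elim!: eventually_mono simp: w_def \<tau>_def)
  have bound: "dist (\<tau> n a) (\<tau> m a) \<le> R * dist (\<tau> n 1) (\<tau> m 1)"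
    if "2 \<le> R" "0 \<le> a" "a \<le> R" "R \<le> l (r n)" "R \<le> l (r m)" for a R n m
    using that \<sigma>0 by (intro busemann_concave_dist_le_at_1[OF bc])
      (auto simp: \<tau>_def intro!: isometric_on_subset[OF iso])
  \<comment> \<open>\<open>bound\<close> carries the Cauchy property from parameter 1 to
    \<open>a\<close>, and completeness supplies the limit. The maximum with 2 in \<open>R\<close>
    meets the condition \<open>2 \<le> R\<close> of \<open>bound\<close>.\<close>
  have "\<exists>q. (\<lambda>n. \<tau> n a) \<longlonglongrightarrow> q" if "0 \<le> a" for a
  proof -
    define R where "R = max 2 a"
    have R: "2 \<le> R" "a \<le> R" by (auto simp: R_def)
    obtain N where N: "\<And>n. N \<le> n \<Longrightarrow> R \<le> l (r n)"
      using ev[of R] by (auto simp: eventually_sequentially)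
    have "Cauchy (\<lambda>n. \<tau> n a)"
    proof (rule metric_CauchyI)
      fix e :: real assume "0 < e"
      then obtain M where M: "\<And>m n. M \<le> m \<Longrightarrow> M \<le> n \<Longrightarrow> dist (\<tau> m 1) (\<tau> n 1) < e / R"
        using metric_CauchyD[OF LIMSEQ_imp_Cauchy[OF \<tau>1], of "e / R"] R by auto
      have "dist (\<tau> m a) (\<tau> n a) < e" if "max M N \<le> m" "max M N \<le> n" for m n
        using bound[of R a m n] M[of m n] N that R \<open>0 \<le> a\<close> by (simp add: field_simps)
      then show "\<exists>M. \<forall>m\<ge>M. \<forall>n\<ge>M. dist (\<tau> m a) (\<tau> n a) < e" by blast
    qed
    then show ?thesis
      using assms(1) by (auto simp: complete_def)
  qed
  then obtain \<rho> where \<rho>: "\<And>a. 0 \<le> a \<Longrightarrow> (\<lambda>n. \<tau> n a) \<longlonglongrightarrow> \<rho> a"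
    by metis
  have "uniform_limit K \<tau> \<rho> sequentially" if "compact K" "K \<subseteq> {0..}" for K
  proof (rule uniform_limitI)
    fix e :: real assume "0 < e"
    obtain B where "\<forall>a\<in>K. \<bar>a\<bar> \<le> B"
      using compact_imp_bounded[OF \<open>compact K\<close>] by (auto simp: bounded_iff)
    then obtain R where R: "2 \<le> R" "\<And>a. a \<in> K \<Longrightarrow> 0 \<le> a \<and> a \<le> R"
      using \<open>K \<subseteq> {0..}\<close> by (intro that[of "max 2 B"]) force+
    have "\<forall>\<^sub>F n in sequentially. dist (\<tau> n 1) (\<rho> 1) < e / R"
      using \<rho>[of 1] \<open>0 < e\<close> R(1) by (intro tendstoD) auto
    with ev[of R] show "\<forall>\<^sub>F n in sequentially. \<forall>a\<in>K. dist (\<tau> n a) (\<rho> a) < e"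
    proof eventually_elim
      case (elim n)
      show ?case
      proof
        fix a assume "a \<in> K"
        then have a: "0 \<le> a" "a \<le> R" using R by auto
        \<comment> \<open>Let \<open>m\<close> tend to infinity in \<open>bound\<close>; the
          resulting estimate is uniform in \<open>a\<close>.\<close>
        have "dist (\<tau> n a) (\<rho> a) \<le> R * dist (\<tau> n 1) (\<rho> 1)"
        proof (rule tendsto_le[OF sequentially_bot])
          show "(\<lambda>m. dist (\<tau> n a) (\<tau> m a)) \<longlonglongrightarrow> dist (\<tau> n a) (\<rho> a)"
            using \<rho> a by (intro tendsto_intros) auto
          show "(\<lambda>m. R * dist (\<tau> n 1) (\<tau> m 1)) \<longlonglongrightarrow> R * dist (\<tau> n 1) (\<rho> 1)"
            using \<rho> by (intro tendsto_intros) auto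
          show "\<forall>\<^sub>F m in sequentially. dist (\<tau> n a) (\<tau> m a) \<le> R * dist (\<tau> n 1) (\<tau> m 1)"
            using ev[of R] bound[OF R(1) a elim(1)] by (auto elim: eventually_mono)
        qed
        also have "\<dots> < e"
          using elim R(1) by (simp add: field_simps)
        finally show "dist (\<tau> n a) (\<rho> a) < e" .
      qed
    qed
  qed
  moreover have "\<rho> 0 = x"
    using \<rho>[of 0] \<sigma>0 by (simp add: \<tau>_def LIMSEQ_const_iff)
  moreover have "is_ray \<rho>"
    unfolding is_ray_def
  proof (rule isometric_on_limit)
    show "\<forall>\<^sub>F n in sequentially. dist (\<tau> n a) (\<tau> n b) = \<bar>a - b\<bar>" if "a \<in> {0..}" "b \<in> {0..}" for a b
      using ev[of "max a b"] that iso
      by (auto elim!: eventually_mono simp: \<tau>_def isometric_on_def)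
  qed (use \<rho> in auto)
  moreover have "filterlim (t \<circ> r) at_top sequentially"
    using filterlim_compose[OF t(2) filterlim_subseq[OF r]] by (simp add: comp_def)
  ultimately have "asymptotic_along \<gamma> (t \<circ> r) (\<sigma> \<circ> r) \<rho>"
    using t(1) \<sigma> by (simp add: asymptotic_along_def flip: \<tau>_def) (simp add: \<tau>_def)
  with r \<open>\<rho> 0 = x\<close> show ?thesis by (rule that)
qed

text \<open>Concavity at the common origin, taken at the affine parameter \<open>s / t n\<close>,
  bounds the distance below by this fraction of \<open>2 * t n\<close>, the distance of the two
  targets. Sharing \<open>t\<close> lets one affine parameter serve both geodesics.\<close>

lemma asymptotic_along_opposite:
  fixes \<gamma> :: "real \<Rightarrow> 'a::metric_space"
  assumes bc: "busemann_concave TYPE('a)" and "is_line \<gamma>"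
    and \<rho>: "asymptotic_along \<gamma> t \<sigma> \<rho>" and \<pi>: "asymptotic_along (\<lambda>r. \<gamma> (- r)) t \<tau> \<pi>"
    and "\<rho> 0 = \<pi> 0" "0 \<le> s"
  shows "2 * s \<le> dist (\<rho> s) (\<pi> s)"
proof (rule tendsto_le[OF sequentially_bot _ tendsto_const])
  have t: "\<And>n. 0 \<le> t n" "filterlim t at_top sequentially"
    using \<rho> by (auto simp: asymptotic_along_def)
  define u v where "u n = s / t n * dist (\<rho> 0) (\<gamma> (t n))"
    and "v n = s / t n * dist (\<pi> 0) (\<gamma> (- t n))" for n
  have lim: "u \<longlonglongrightarrow> s" "v \<longlonglongrightarrow> s"
    unfolding u_def v_def
    using ray_dist_ratio[OF is_line_imp_is_ray[OF \<open>is_line \<gamma>\<close>] t]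
      ray_dist_ratio[OF is_line_imp_is_ray[OF is_line_reverse[OF \<open>is_line \<gamma>\<close>]] t] by auto
  have nonneg: "0 \<le> u n" "0 \<le> v n" for n
    using t(1) \<open>0 \<le> s\<close> by (auto simp: u_def v_def)
  show "(\<lambda>n. dist (\<sigma> n (u n)) (\<tau> n (v n))) \<longlonglongrightarrow> dist (\<rho> s) (\<pi> s)"
    by (rule tendsto_dist[OF asymptotic_along_tendsto[OF \<rho> lim(1) nonneg(1)]
        asymptotic_along_tendsto[OF \<pi> lim(2) nonneg(2)]])
  \<comment> \<open>This makes \<open>t n\<close> positive and puts \<open>s / t n\<close> into
    [0, 1].\<close>
  have "\<forall>\<^sub>F n in sequentially. max 1 s \<le> t n"
    using t(2) unfolding filterlim_at_top by blast
  then show "\<forall>\<^sub>F n in sequentially. 2 * s \<le> dist (\<sigma> n (u n)) (\<tau> n (v n))"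
  proof eventually_elim
    case (elim n)
    have "is_geodesic (\<lambda>a. \<sigma> n (a * dist (\<rho> 0) (\<gamma> (t n)))) (\<rho> 0) (\<gamma> (t n))"
      "is_geodesic (\<lambda>a. \<tau> n (a * dist (\<pi> 0) (\<gamma> (- t n)))) (\<rho> 0) (\<gamma> (- t n))"
      using \<rho> \<pi> \<open>\<rho> 0 = \<pi> 0\<close> by (auto simp: asymptotic_along_def intro: unit_speed_geodesic_rescale)
    from busemann_concave_dist_ge[OF bc this, of "s / t n"]
    have "s / t n * dist (\<gamma> (t n)) (\<gamma> (- t n)) \<le> dist (\<sigma> n (u n)) (\<tau> n (v n))"
      using elim \<open>0 \<le> s\<close> by (simp add: u_def v_def)
    moreover have "dist (\<gamma> (t n)) (\<gamma> (- t n)) = 2 * t n"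
      using \<open>is_line \<gamma>\<close> elim by (simp add: is_line_def isometric_on_def)
    ultimately show ?case using elim by simp
  qed
qed

text \<open>The approximating geodesics end at the same point \<open>\<gamma> (t n)\<close>.
  Reversed, they have a common origin, and concavity at parameter \<open>1 - s / t n\<close> loses
  only a factor that tends to 1.\<close>

lemma asymptotic_along_dist_mono:
  fixes \<gamma> :: "real \<Rightarrow> 'a::metric_space"
  assumes bc: "busemann_concave TYPE('a)" and "is_ray \<gamma>"
    and \<rho>: "asymptotic_along \<gamma> t \<sigma> \<rho>" and \<pi>: "asymptotic_along \<gamma> t \<tau> \<pi>" and "0 \<le> s"
  shows "dist (\<rho> 0) (\<pi> 0) \<le> dist (\<rho> s) (\<pi> s)"
proof (rule tendsto_le[OF sequentially_bot])
  have t: "\<And>n. 0 \<le> t n" "filterlim t at_top sequentially"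
    using \<rho> by (auto simp: asymptotic_along_def)
  define u v where "u n = s / t n * dist (\<rho> 0) (\<gamma> (t n))"
    and "v n = s / t n * dist (\<pi> 0) (\<gamma> (t n))" for n
  have lim: "u \<longlonglongrightarrow> s" "v \<longlonglongrightarrow> s"
    unfolding u_def v_def using ray_dist_ratio[OF \<open>is_ray \<gamma>\<close> t] by auto
  have nonneg: "0 \<le> u n" "0 \<le> v n" for n
    using t(1) \<open>0 \<le> s\<close> by (auto simp: u_def v_def)
  show "(\<lambda>n. dist (\<sigma> n (u n)) (\<tau> n (v n))) \<longlonglongrightarrow> dist (\<rho> s) (\<pi> s)"
    by (rule tendsto_dist[OF asymptotic_along_tendsto[OF \<rho> lim(1) nonneg(1)]
        asymptotic_along_tendsto[OF \<pi> lim(2) nonneg(2)]])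
  have "(\<lambda>n. s / t n) \<longlonglongrightarrow> 0"
    using t(2) by (intro tendsto_divide_0[OF tendsto_const] filterlim_at_top_imp_at_infinity)
  then have "(\<lambda>n. (1 - s / t n) * dist (\<rho> 0) (\<pi> 0)) \<longlonglongrightarrow> (1 - 0) * dist (\<rho> 0) (\<pi> 0)"
    by (intro tendsto_intros)
  then show "(\<lambda>n. (1 - s / t n) * dist (\<rho> 0) (\<pi> 0)) \<longlonglongrightarrow> dist (\<rho> 0) (\<pi> 0)"
    by simp
  have "\<forall>\<^sub>F n in sequentially. max 1 s \<le> t n"
    using t(2) unfolding filterlim_at_top by blast
  then show "\<forall>\<^sub>F n in sequentially. (1 - s / t n) * dist (\<rho> 0) (\<pi> 0) \<le> dist (\<sigma> n (u n)) (\<tau> n (v n))"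
  proof eventually_elim
    case (elim n)
    have "is_geodesic (\<lambda>a. \<sigma> n (a * dist (\<rho> 0) (\<gamma> (t n)))) (\<rho> 0) (\<gamma> (t n))"
      "is_geodesic (\<lambda>a. \<tau> n (a * dist (\<pi> 0) (\<gamma> (t n)))) (\<pi> 0) (\<gamma> (t n))"
      using \<rho> \<pi> by (auto simp: asymptotic_along_def intro: unit_speed_geodesic_rescale)
    from busemann_concave_dist_ge[OF bc this[THEN is_geodesic_reverse], of "1 - s / t n"]
    show ?case
      using elim \<open>0 \<le> s\<close> by (simp add: u_def v_def)
  qed
qed

subsection \<open>Busemann functions\<close>

text \<open>The sign is chosen so that the function increases along \<open>\<gamma>\<close>. The
  supremum is also the limit at infinity, by \<open>busemann_tendsto\<close>.\<close>

definition busemann :: "(real \<Rightarrow> 'a::metric_space) \<Rightarrow> 'a \<Rightarrow> real" where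
  "busemann \<gamma> x = (SUP t\<in>{0..}. t - dist x (\<gamma> t))"

text \<open>By the triangle inequality the expression is nondecreasing in \<open>t\<close> and
  bounded by \<open>dist x (\<gamma> 0)\<close>.\<close>

lemma busemann_tendsto:
  assumes "is_ray \<gamma>"
  shows "((\<lambda>t. t - dist x (\<gamma> t)) \<longlongrightarrow> busemann \<gamma> x) at_top"
proof (rule increasing_tendsto)
  have bdd: "bdd_above ((\<lambda>t. t - dist x (\<gamma> t)) ` {0..})"
    using ray_dist_bounds[OF assms, of _ x] by (intro bdd_aboveI2[of _ _ "dist x (\<gamma> 0)"]) force
  show "\<forall>\<^sub>F t in at_top. t - dist x (\<gamma> t) \<le> busemann \<gamma> x"
    using eventually_ge_at_top[of 0]
    by eventually_elim (auto simp: busemann_def intro!: cSUP_upper bdd)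
  fix y assume "y < busemann \<gamma> x"
  then obtain s where s: "0 \<le> s" "y < s - dist x (\<gamma> s)"
    unfolding busemann_def using bdd by (subst (asm) less_cSUP_iff) auto
  show "\<forall>\<^sub>F t in at_top. y < t - dist x (\<gamma> t)"
    using eventually_ge_at_top[of s]
  proof eventually_elim
    case (elim t)
    then have "dist (\<gamma> s) (\<gamma> t) = t - s"
      using assms s(1) by (simp add: is_ray_def isometric_on_def)
    then show ?case
      using s(2) dist_triangle[of x "\<gamma> t" "\<gamma> s"] by linarith
  qed
qed

lemma busemann_diff_le:
  assumes "is_ray \<gamma>"
  shows "busemann \<gamma> x - busemann \<gamma> y \<le> dist x y"
proof -
  have "busemann \<gamma> x \<le> busemann \<gamma> y + dist x y"
  proof (rule tendsto_le[OF trivial_limit_at_top_linorder])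
    show "((\<lambda>t. t - dist x (\<gamma> t)) \<longlongrightarrow> busemann \<gamma> x) at_top"
      using assms by (rule busemann_tendsto)
    show "((\<lambda>t. t - dist y (\<gamma> t) + dist x y) \<longlongrightarrow> busemann \<gamma> y + dist x y) at_top"
      using assms by (intro tendsto_add busemann_tendsto tendsto_const)
    show "\<forall>\<^sub>F t in at_top. t - dist x (\<gamma> t) \<le> t - dist y (\<gamma> t) + dist x y"
      using dist_triangle3[of y _ x] by (intro always_eventually allI) (smt (verit))
  qed
  then show ?thesis by simp
qed

text \<open>Moving by \<open>s\<close> along a geodesic towards \<open>\<gamma> (t n)\<close>
  shortens the distance to that point by exactly \<open>s\<close>. Replacing
  \<open>\<sigma> n s\<close> by \<open>\<rho> s\<close> costs an error that tends to 0.\<close>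

lemma busemann_asymptotic:
  assumes "asymptotic_ray \<rho> \<gamma>" "0 \<le> s"
  shows "busemann \<gamma> (\<rho> s) = busemann \<gamma> (\<rho> 0) + s"
proof -
  obtain t \<sigma> where \<gamma>: "is_ray \<gamma>" and \<rho>: "asymptotic_along \<gamma> t \<sigma> \<rho>"
    using assms(1) by (auto simp: asymptotic_ray_iff)
  have t: "\<And>n. 0 \<le> t n" "filterlim t at_top sequentially"
    using \<rho> by (auto simp: asymptotic_along_def)
  have lim: "(\<lambda>n. t n - dist x (\<gamma> (t n))) \<longlonglongrightarrow> busemann \<gamma> x" for x
    by (rule filterlim_compose[OF busemann_tendsto[OF \<gamma>] t(2)])
  have \<sigma>s: "(\<lambda>n. \<sigma> n s) \<longlonglongrightarrow> \<rho> s"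
    by (rule asymptotic_along_tendsto[OF \<rho> tendsto_const \<open>0 \<le> s\<close>])
  have "\<forall>\<^sub>F n in sequentially. s \<le> dist (\<rho> 0) (\<gamma> (t n))"
    using ray_dist_at_top[OF \<gamma> t] unfolding filterlim_at_top by blast
  then have "\<forall>\<^sub>F n in sequentially.
      norm ((t n - dist (\<rho> s) (\<gamma> (t n))) - (t n - dist (\<rho> 0) (\<gamma> (t n)) + s)) \<le> dist (\<sigma> n s) (\<rho> s)"
  proof eventually_elim
    case (elim n)
    have "unit_speed_geodesic (\<sigma> n) (\<rho> 0) (\<gamma> (t n))"
      using \<rho> by (simp add: asymptotic_along_def)
    then have "dist (\<sigma> n s) (\<gamma> (t n)) = dist (\<rho> 0) (\<gamma> (t n)) - s"
      using isometric_onD[of "{0..dist (\<rho> 0) (\<gamma> (t n))}" "\<sigma> n" s "dist (\<rho> 0) (\<gamma> (t n))"] elim \<open>0 \<le> s\<close>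
      by (simp add: unit_speed_geodesic_def)
    then show ?case
      using abs_dist_diff_le[of "\<sigma> n s" "\<gamma> (t n)" "\<rho> s"]
      by (simp add: dist_commute[of "\<gamma> (t n)" "\<rho> s"])
  qed
  moreover have "(\<lambda>n. dist (\<sigma> n s) (\<rho> s)) \<longlonglongrightarrow> 0"
    using \<sigma>s unfolding tendsto_dist_iff[of "\<lambda>n. \<sigma> n s"] .
  ultimately have "(\<lambda>n. (t n - dist (\<rho> s) (\<gamma> (t n))) - (t n - dist (\<rho> 0) (\<gamma> (t n)) + s)) \<longlonglongrightarrow> 0"
    by (rule Lim_null_comparison)
  moreover have "(\<lambda>n. (t n - dist (\<rho> s) (\<gamma> (t n))) - (t n - dist (\<rho> 0) (\<gamma> (t n)) + s))
      \<longlonglongrightarrow> busemann \<gamma> (\<rho> s) - (busemann \<gamma> (\<rho> 0) + s)"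
    by (intro tendsto_diff tendsto_add lim tendsto_const)
  ultimately have "busemann \<gamma> (\<rho> s) - (busemann \<gamma> (\<rho> 0) + s) = 0"
    by (rule LIMSEQ_unique[symmetric])
  then show ?thesis by simp
qed

text \<open>The Busemann function grows at unit speed along the concatenation of the two rays, so the
  concatenation is a ray and cannot branch off from \<open>\<rho>\<close>.\<close>

lemma asymptotic_ray_restart:
  fixes \<gamma> :: "real \<Rightarrow> 'a::metric_space"
  assumes bc: "busemann_concave TYPE('a)" and \<rho>: "asymptotic_ray \<rho> \<gamma>" and \<rho>': "asymptotic_ray \<rho>' \<gamma>"
    and "\<rho>' 0 = \<rho> s" "0 < s" "0 \<le> r"
  shows "\<rho>' r = \<rho> (s + r)"
proof -
  have rays: "is_ray \<gamma>" "is_ray \<rho>" "is_ray \<rho>'"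
    using \<rho> \<rho>' by (auto simp: asymptotic_ray_def)
  define \<zeta> where "\<zeta> a = (if a \<le> s then \<rho> a else \<rho>' (a - s))" for a
  have \<zeta>: "dist (\<zeta> a) (\<zeta> b) = b - a" if ab: "0 \<le> a" "a \<le> b" for a b
  proof -
    consider "b \<le> s" | "a \<le> s" "s < b" | "s < a" by linarith
    then show ?thesis
    proof cases
      case 2
      \<comment> \<open>Across the junction, the 1-Lipschitz Busemann function gives the lower bound
        and the path through \<open>\<rho> s\<close> the upper one.\<close>
      have "busemann \<gamma> (\<rho>' (b - s)) - busemann \<gamma> (\<rho> a) = b - a"
        using busemann_asymptotic[OF \<rho>', of "b - s"] busemann_asymptotic[OF \<rho>, of s]
          busemann_asymptotic[OF \<rho>, of a] 2 ab \<open>\<rho>' 0 = \<rho> s\<close> by simp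
      then have "b - a \<le> dist (\<rho> a) (\<rho>' (b - s))"
        using busemann_diff_le[OF rays(1), of "\<rho>' (b - s)" "\<rho> a"] by (simp add: dist_commute)
      moreover have "dist (\<rho> a) (\<rho> s) = s - a" "dist (\<rho>' 0) (\<rho>' (b - s)) = b - s"
        using rays 2 ab by (auto simp: is_ray_def isometric_on_def)
      ultimately have "dist (\<rho> a) (\<rho>' (b - s)) = b - a"
        using dist_triangle[of "\<rho> a" "\<rho>' (b - s)" "\<rho> s"] \<open>\<rho>' 0 = \<rho> s\<close> by simp
      then show ?thesis using 2 by (simp add: \<zeta>_def)
    qed (use rays ab in \<open>auto simp: \<zeta>_def is_ray_def isometric_on_def\<close>)
  qed
  have "is_ray \<zeta>"
    unfolding is_ray_def isometric_on_def
  proof (intro ballI)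
    fix a b :: real assume "a \<in> {0..}" "b \<in> {0..}"
    then show "dist (\<zeta> a) (\<zeta> b) = \<bar>a - b\<bar>"
      using \<zeta>[of a b] \<zeta>[of b a] by (cases "a \<le> b") (auto simp: dist_commute)
  qed
  have "\<zeta> (s + r) = \<rho> (s + r)"
  proof (rule rays_nonbranching[OF bc \<open>is_ray \<zeta>\<close> rays(2) _ \<open>0 < s\<close>])
    show "\<zeta> a = \<rho> a" if "a \<le> s" for a
      using that by (simp add: \<zeta>_def)
  qed (use assms(5,6) in simp)
  \<comment> \<open>At the junction \<open>\<zeta>\<close> takes its value from
    \<open>\<rho>\<close>, so \<open>r = 0\<close> rests on \<open>\<rho>' 0 = \<rho> s\<close>
    instead.\<close>
  then show ?thesis
    using assms(4-6) by (cases "r = 0") (auto simp: \<zeta>_def)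
qed

subsection \<open>Lines bi-asymptotic to a given line\<close>

text \<open>With \<open>m\<close> the larger of two parameters \<open>a\<close>, \<open>b\<close>,
  the path from \<open>\<rho> m\<close> via \<open>\<rho> a\<close> and \<open>\<pi> b\<close> to
  \<open>\<pi> m\<close> has length at least \<open>2 * m\<close>, which forces
  \<open>\<rho> a\<close> and \<open>\<pi> b\<close> to be at least \<open>a + b\<close>
  apart.\<close>

lemma is_line_glue:
  fixes \<rho> \<pi> :: "real \<Rightarrow> 'a::metric_space"
  assumes "is_ray \<rho>" "is_ray \<pi>" "\<rho> 0 = \<pi> 0" and far: "\<And>s. 0 \<le> s \<Longrightarrow> 2 * s \<le> dist (\<rho> s) (\<pi> s)"
  shows "is_line (\<lambda>r. if 0 \<le> r then \<rho> r else \<pi> (- r))"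
proof -
  have \<rho>\<pi>: "dist (\<rho> a) (\<pi> b) = a + b" if "0 \<le> a" "0 \<le> b" for a b
  proof -
    define m where "m = max a b"
    have d: "dist (\<rho> m) (\<rho> a) = m - a" "dist (\<pi> b) (\<pi> m) = m - b"
      "dist (\<rho> a) (\<rho> 0) = a" "dist (\<pi> 0) (\<pi> b) = b"
      using assms(1,2) that by (auto simp: is_ray_def isometric_on_def m_def)
    have "2 * m \<le> dist (\<rho> m) (\<pi> m)"
      using that by (intro far) (simp add: m_def)
    then show ?thesis
      using d dist_triangle[of "\<rho> m" "\<pi> m" "\<rho> a"] dist_triangle[of "\<rho> a" "\<pi> m" "\<pi> b"]
        dist_triangle[of "\<rho> a" "\<pi> b" "\<rho> 0"] assms(3) by simp
  qed
  have \<pi>\<rho>: "dist (\<pi> b) (\<rho> a) = a + b" if "0 \<le> a" "0 \<le> b" for a b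
    using \<rho>\<pi>[OF that] by (simp add: dist_commute)
  show ?thesis
    unfolding is_line_def isometric_on_def
    using assms(1,2) \<rho>\<pi> \<pi>\<rho> by (auto simp: is_ray_def isometric_on_def)
qed

lemma bi_asymptotic_reverse:
  "bi_asymptotic L \<gamma> \<Longrightarrow> bi_asymptotic (\<lambda>t. L (- t)) (\<lambda>t. \<gamma> (- t))"
  by (simp add: bi_asymptotic_def is_line_reverse)

text \<open>The point \<open>L (- s)\<close> is interior to the backward ray of \<open>L\<close>, so
  the backward halves agree by \<open>asymptotic_ray_restart\<close>; non-branching extends this to
  the forward halves.\<close>

lemma bi_asymptotic_restart_backward:
  fixes \<gamma> :: "real \<Rightarrow> 'a::metric_space"
  assumes bc: "busemann_concave TYPE('a)" and L: "bi_asymptotic L \<gamma>" and L': "bi_asymptotic L' \<gamma>"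
    and "L' 0 = L (- s)" "0 < s"
  shows "L' r = L (r - s)"
proof (rule lines_nonbranching[OF bc, of L' "\<lambda>r. L (r - s)"])
  show "is_line L'" "is_line (\<lambda>r. L (r - s))"
    using L L' is_line_shift[of L "- s"] by (auto simp: bi_asymptotic_def)
  fix r :: real assume "r \<le> 0"
  have "asymptotic_ray (\<lambda>t. L (- t)) (\<lambda>t. \<gamma> (- t))" "asymptotic_ray (\<lambda>t. L' (- t)) (\<lambda>t. \<gamma> (- t))"
    using L L' by (auto simp: bi_asymptotic_def)
  from asymptotic_ray_restart[OF bc this, of s "- r"] show "L' r = L (r - s)"
    using assms(4,5) \<open>r \<le> 0\<close> by simp
qed

text \<open>For \<open>s \<noteq> 0\<close> the new origin is interior to one half of
  \<open>L\<close>; reversal of all lines exchanges the halves. The case of a common origin is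
  \<open>bi_asymptotic_unique\<close>.\<close>

lemma bi_asymptotic_restart:
  fixes \<gamma> :: "real \<Rightarrow> 'a::metric_space"
  assumes bc: "busemann_concave TYPE('a)" and L: "bi_asymptotic L \<gamma>" and L': "bi_asymptotic L' \<gamma>"
    and "L' 0 = L s" "s \<noteq> 0"
  shows "L' r = L (r + s)"
proof (cases "s < 0")
  case True
  then show ?thesis
    using bi_asymptotic_restart_backward[OF bc L L', of "- s"] assms(4) by simp
next
  case False
  then show ?thesis
    using bi_asymptotic_restart_backward[OF bc bi_asymptotic_reverse[OF L] bi_asymptotic_reverse[OF L'], of s "- r"]
      assms(4,5) by (simp add: add.commute)
qed

text \<open>The locale is reinterpreted at the reversed line, which turns each forward statement
  into a backward one.\<close>

locale concave_space_with_line =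
  fixes \<gamma> :: "real \<Rightarrow> 'a::metric_space"
  assumes complete: "complete (UNIV :: 'a set)"
    and proper: "proper_space TYPE('a)"
    and concave: "busemann_concave TYPE('a)"
    and line: "is_line \<gamma>"
begin

lemma reverse: "concave_space_with_line (\<lambda>t. \<gamma> (- t))"
  using complete proper concave is_line_reverse[OF line] by unfold_locales

lemma ray: "is_ray \<gamma>"
  using line by (rule is_line_imp_is_ray)

lemma asymptotic_along_exists_from:
  assumes "\<And>n. 0 \<le> t n" "filterlim t at_top sequentially"
  obtains r \<sigma> \<rho> where "strict_mono r" "\<rho> 0 = x" "asymptotic_along \<gamma> (t \<circ> r) \<sigma> \<rho>"
proof -
  have "geodesic_space TYPE('a)"
    using concave by (simp add: busemann_concave_def)
  then have "\<exists>c. unit_speed_geodesic c x (\<gamma> (t n))" for n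
    by (metis unit_speed_geodesic_exists)
  then obtain \<sigma> where \<sigma>: "\<And>n. unit_speed_geodesic (\<sigma> n) x (\<gamma> (t n))" by metis
  obtain r \<rho> where "strict_mono r" "\<rho> 0 = x" "asymptotic_along \<gamma> (t \<circ> r) (\<sigma> \<circ> r) \<rho>"
    by (rule asymptotic_along_exists[OF complete proper concave ray assms \<sigma>])
  then show ?thesis by (rule that)
qed

lemma bi_asymptotic_exists:
  obtains L where "bi_asymptotic L \<gamma>" "L 0 = x"
proof -
  interpret R: concave_space_with_line "\<lambda>t. \<gamma> (- t)" by (rule reverse)
  obtain r \<sigma> \<rho> where \<rho>: "strict_mono r" "\<rho> 0 = x" "asymptotic_along \<gamma> (real \<circ> r) \<sigma> \<rho>"
    using asymptotic_along_exists_from[of real x] filterlim_real_sequentially of_nat_0_le_iff by metis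
  then have "\<And>n. 0 \<le> (real \<circ> r) n" "filterlim (real \<circ> r) at_top sequentially"
    by (auto simp: asymptotic_along_def)
  then obtain r' \<tau> \<pi> where \<pi>: "strict_mono r'" "\<pi> 0 = x"
      "asymptotic_along (\<lambda>t. \<gamma> (- t)) (real \<circ> r \<circ> r') \<tau> \<pi>"
    using R.asymptotic_along_exists_from[of "real \<circ> r" x] by metis
  have \<rho>': "asymptotic_along \<gamma> (real \<circ> r \<circ> r') (\<sigma> \<circ> r') \<rho>"
    using asymptotic_along_subseq[OF \<rho>(3) \<pi>(1)] .
  define L where "L s = (if 0 \<le> s then \<rho> s else \<pi> (- s))" for s
  have "is_line L"
    unfolding L_def
    using \<rho>' \<pi> \<rho>(2) asymptotic_along_opposite[OF concave line \<rho>' \<pi>(3)]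
    by (intro is_line_glue) (auto simp: asymptotic_along_def)
  moreover have "asymptotic_ray L \<gamma>"
  proof (rule asymptotic_ray_cong)
    show "asymptotic_ray \<rho> \<gamma>"
      unfolding asymptotic_ray_iff using \<rho>(3) ray by blast
  qed (simp add: L_def)
  moreover have "asymptotic_ray (\<lambda>t. L (- t)) (\<lambda>t. \<gamma> (- t))"
  proof (rule asymptotic_ray_cong)
    show "asymptotic_ray \<pi> (\<lambda>t. \<gamma> (- t))"
      unfolding asymptotic_ray_iff using \<pi>(3) R.ray by blast
  qed (use \<rho>(2) \<pi>(2) in \<open>auto simp: L_def\<close>)
  ultimately have "bi_asymptotic L \<gamma>"
    using line by (simp add: bi_asymptotic_def)
  then show ?thesis
    using \<rho>(2) by (intro that[of L]) (auto simp: L_def)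
qed

text \<open>The origin of \<open>\<rho>\<close> is interior to the forward ray of the line through
  \<open>L (- 1)\<close>, where asymptotic rays are already known to be unique; that line is a shift
  of \<open>L\<close>.\<close>

lemma asymptotic_ray_unique:
  assumes L: "bi_asymptotic L \<gamma>" and \<rho>: "asymptotic_ray \<rho> \<gamma>" and "\<rho> 0 = L 0" "0 \<le> r"
  shows "\<rho> r = L r"
proof -
  obtain L' where L': "bi_asymptotic L' \<gamma>" "L' 0 = L (- 1)"
    by (rule bi_asymptotic_exists)
  have L'_eq: "L' r = L (r - 1)" for r
    using bi_asymptotic_restart[OF concave L L'] by simp
  have "asymptotic_ray L' \<gamma>"
    using L'(1) by (simp add: bi_asymptotic_def)
  from asymptotic_ray_restart[OF concave this \<rho>, of 1 r] have "\<rho> r = L' (1 + r)"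
    using assms(3,4) by (simp add: L'_eq)
  then show ?thesis by (simp add: L'_eq)
qed

lemma bi_asymptotic_unique:
  assumes L: "bi_asymptotic L \<gamma>" and L': "bi_asymptotic L' \<gamma>" and "L 0 = L' 0"
  shows "L = L'"
proof
  interpret R: concave_space_with_line "\<lambda>t. \<gamma> (- t)" by (rule reverse)
  fix r
  show "L r = L' r"
  proof (cases "0 \<le> r")
    case True
    then show ?thesis
      using asymptotic_ray_unique[OF L', of L r] L assms(3) by (simp add: bi_asymptotic_def)
  next
    case False
    then show ?thesis
      using R.asymptotic_ray_unique[OF bi_asymptotic_reverse[OF L'], of "\<lambda>t. L (- t)" "- r"] L assms(3)
      by (simp add: bi_asymptotic_def)
  qed
qed

subsection \<open>The flow along parallel lines\<close>

text \<open>The choice is canonical by \<open>bi_asymptotic_unique\<close>.\<close>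

definition flow :: "'a \<Rightarrow> real \<Rightarrow> 'a" where
  "flow x = (SOME L. bi_asymptotic L \<gamma> \<and> L 0 = x)"

lemma bi_asymptotic_flow: "bi_asymptotic (flow x) \<gamma>" and flow_0 [simp]: "flow x 0 = x"
proof -
  have "\<exists>L. bi_asymptotic L \<gamma> \<and> L 0 = x"
    using bi_asymptotic_exists by blast
  then have "bi_asymptotic (flow x) \<gamma> \<and> flow x 0 = x"
    unfolding flow_def by (rule someI_ex)
  then show "bi_asymptotic (flow x) \<gamma>" "flow x 0 = x" by auto
qed

lemma flow_eqI: "bi_asymptotic L \<gamma> \<Longrightarrow> L 0 = x \<Longrightarrow> flow x = L"
  by (rule bi_asymptotic_unique[OF bi_asymptotic_flow]) simp_all

lemma flow_flow: "flow (flow x s) r = flow x (r + s)"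
proof (cases "s = 0")
  case True
  then show ?thesis by simp
next
  case False
  show ?thesis
    by (rule bi_asymptotic_restart[OF concave bi_asymptotic_flow bi_asymptotic_flow _ False]) simp
qed

lemma is_line_flow: "is_line (flow x)"
  using bi_asymptotic_flow[of x] by (simp add: bi_asymptotic_def)

text \<open>Each shift of a flow line is again a flow line, which upgrades bi-asymptotic to
  parallel.\<close>

lemma parallel_line_flow: "parallel_line (flow x) \<gamma>"
  unfolding parallel_line_def
proof
  fix s
  have "flow (flow x s) = (\<lambda>t. flow x (t + s))"
    by (rule ext) (rule flow_flow)
  then show "bi_asymptotic (\<lambda>t. flow x (t + s)) \<gamma>"
    using bi_asymptotic_flow[of "flow x s"] by simp
qed

text \<open>Two successive extractions give limit rays at \<open>x\<close> and \<open>y\<close> with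
  common parameters; by uniqueness these are the forward flow lines.\<close>

lemma flow_expanding:
  assumes "0 \<le> s"
  shows "dist x y \<le> dist (flow x s) (flow y s)"
proof -
  obtain r \<sigma> \<rho> where \<rho>: "strict_mono r" "\<rho> 0 = x" "asymptotic_along \<gamma> (real \<circ> r) \<sigma> \<rho>"
    using asymptotic_along_exists_from[of real x] filterlim_real_sequentially of_nat_0_le_iff by metis
  then have "\<And>n. 0 \<le> (real \<circ> r) n" "filterlim (real \<circ> r) at_top sequentially"
    by (auto simp: asymptotic_along_def)
  then obtain r' \<tau> \<pi> where \<pi>: "strict_mono r'" "\<pi> 0 = y" "asymptotic_along \<gamma> (real \<circ> r \<circ> r') \<tau> \<pi>"
    using asymptotic_along_exists_from[of "real \<circ> r" y] by metis
  have "asymptotic_ray \<rho> \<gamma>" "asymptotic_ray \<pi> \<gamma>"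
    unfolding asymptotic_ray_iff using \<rho>(3) \<pi>(3) ray by blast+
  then have "\<rho> s = flow x s" "\<pi> s = flow y s"
    using asymptotic_ray_unique[OF bi_asymptotic_flow] \<rho>(2) \<pi>(2) assms by auto
  then show ?thesis
    using asymptotic_along_dist_mono[OF concave ray asymptotic_along_subseq[OF \<rho>(3) \<pi>(1)] \<pi>(3) assms]
      \<rho>(2) \<pi>(2) by simp
qed

text \<open>The flow of the reversed line is the flow run backwards, so every time \<open>s\<close>
  is expanding. Applied to the inverse time \<open>- s\<close>, this gives the opposite
  inequality.\<close>

lemma flow_isometry: "dist (flow x s) (flow y s) = dist x y"
proof -
  interpret R: concave_space_with_line "\<lambda>t. \<gamma> (- t)" by (rule reverse)
  have R: "R.flow x = (\<lambda>t. flow x (- t))" for x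
    by (intro R.flow_eqI bi_asymptotic_reverse bi_asymptotic_flow) simp
  have le: "dist x y \<le> dist (flow x s) (flow y s)" for x y s
    using flow_expanding[of s x y] R.flow_expanding[of "- s" x y] by (cases "0 \<le> s") (auto simp: R)
  show ?thesis
    using le[of x y s] le[of "flow x s" "flow y s" "- s"] by (simp add: flow_flow)
qed

section \<open>The Busemann function as height, and the product decomposition\<close>

lemma busemann_flow: "busemann \<gamma> (flow x s) = busemann \<gamma> x + s"
proof -
  have pos: "busemann \<gamma> (flow x s) = busemann \<gamma> x + s" if "0 \<le> s" for x s
    using busemann_asymptotic[OF _ that, of "flow x"] bi_asymptotic_flow by (simp add: bi_asymptotic_def)
  show ?thesis
    using pos[of s x] pos[of "- s" "flow x s"] by (cases "0 \<le> s") (auto simp: flow_flow)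
qed

lemma busemann_dist_le: "\<bar>busemann \<gamma> x - busemann \<gamma> y\<bar> \<le> dist x y"
  using busemann_diff_le[OF ray, of x y] busemann_diff_le[OF ray, of y x] by (simp add: dist_commute)

lemma flow_dist_le: "dist (flow x s) (flow y t) \<le> dist x y + \<bar>s - t\<bar>"
proof -
  have "dist (flow y s) (flow y t) = \<bar>s - t\<bar>"
    using is_line_flow by (simp add: is_line_def isometric_on_def)
  then show ?thesis
    using dist_triangle[of "flow x s" "flow y t" "flow y s"] flow_isometry by simp
qed

lemma parallel_line_exists_unique:
  "\<exists>\<eta>. is_line \<eta> \<and> parallel_line \<eta> \<gamma> \<and> x \<in> range \<eta> \<and>
     (\<forall>\<eta>'. is_line \<eta>' \<and> parallel_line \<eta>' \<gamma> \<and> x \<in> range \<eta>' \<longrightarrow> (\<exists>s. \<forall>t. \<eta>' t = \<eta> (t + s)))"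
proof (intro exI[of _ "flow x"] conjI allI impI)
  show "x \<in> range (flow x)"
    using flow_0 by (metis rangeI)
  fix \<eta>' assume "is_line \<eta>' \<and> parallel_line \<eta>' \<gamma> \<and> x \<in> range \<eta>'"
  \<comment> \<open>Parallelism is applied to the shift that puts \<open>x\<close> at parameter
    0.\<close>
  then obtain s where s: "x = \<eta>' s" "bi_asymptotic (\<lambda>t. \<eta>' (t + s)) \<gamma>"
    by (auto simp: parallel_line_def)
  then have "flow x = (\<lambda>t. \<eta>' (t + s))"
    by (intro flow_eqI) auto
  then have "\<forall>t. \<eta>' t = flow x (t + - s)" by simp
  then show "\<exists>s. \<forall>t. \<eta>' t = flow x (t + s)" by blast
qed (rule is_line_flow parallel_line_flow)+

text \<open>A point is sent to its flow projection on the zero level together with its height;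
  flowing back up inverts this. Here \<open>euclidean_metric\<close> denotes the metric of the type
  class.\<close>

lemma bi_lipschitz_product:
  defines "X' \<equiv> submetric euclidean_metric {x. busemann \<gamma> x = 0}"
  shows "bi_lipschitz_homeomorphic (euclidean_metric :: 'a metric) (prod_metric X' (euclidean_metric :: real metric))"
  unfolding bi_lipschitz_homeomorphic_def
proof (intro exI conjI)
  let ?f = "\<lambda>x. (flow x (- busemann \<gamma> x), busemann \<gamma> x)"
  let ?g = "\<lambda>(x, t). flow x t"
  have "Lipschitz_continuous_map euclidean_metric X' (\<lambda>x. flow x (- busemann \<gamma> x))"
    unfolding Lipschitz_continuous_map_def
  \<comment> \<open>The constant 2 adds the distance of the points and the difference of their flow
    times, itself at most that distance.\<close>
  proof (intro conjI exI[of _ 2] ballI)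
    fix x y :: 'a
    show "mdist X' (flow x (- busemann \<gamma> x)) (flow y (- busemann \<gamma> y)) \<le> 2 * mdist euclidean_metric x y"
      using flow_dist_le[of x "- busemann \<gamma> x" y "- busemann \<gamma> y"] busemann_dist_le[of x y]
      by (simp add: X'_def)
  qed (simp add: X'_def busemann_flow)
  moreover have "Lipschitz_continuous_map euclidean_metric euclidean_metric (busemann \<gamma>)"
    unfolding Lipschitz_continuous_map_def
    using busemann_dist_le by (auto simp: dist_real_def intro!: exI[of _ 1])
  ultimately show "Lipschitz_continuous_map euclidean_metric (prod_metric X' euclidean_metric) ?f"
    by (simp add: Lipschitz_continuous_map_pairwise comp_def)
  show "Lipschitz_continuous_map (prod_metric X' euclidean_metric) euclidean_metric ?g"
    unfolding Lipschitz_continuous_map_def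
  \<comment> \<open>Each of the two component distances is at most the product distance.\<close>
  proof (intro conjI exI[of _ 2] ballI)
    fix p q :: "'a \<times> real"
    obtain x s y t where pq: "p = (x, s)" "q = (y, t)" by fastforce
    have "dist (?g p) (?g q) \<le> dist x y + dist s t"
      using flow_dist_le by (simp add: pq dist_real_def)
    also have "\<dots> \<le> 2 * dist p q"
      using dist_fst_le[of p q] dist_snd_le[of p q] by (simp add: pq)
    finally show "mdist euclidean_metric (?g p) (?g q) \<le> 2 * mdist (prod_metric X' euclidean_metric) p q"
      by (simp add: X'_def)
  qed auto
qed (auto simp: X'_def busemann_flow flow_flow)

end

lemma is_product_metric_prod_metric:
  "is_product_metric X' (prod_metric X' (euclidean_metric :: real metric))"
  unfolding is_product_metric_def
\<comment> \<open>\<open>prod_metric\<close> combines the two distances by the Euclidean norm of the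
  plane.\<close>
proof (intro conjI exI[of _ norm])
  show "is_norm_R2 norm"
    by (auto simp: is_norm_R2_def norm_triangle_ineq)
qed (auto simp: prod_dist_def norm_Pair dist_real_def)

theorem theorem2p14:
  fixes \<gamma> :: "real \<Rightarrow> 'a::metric_space"
  assumes "complete (UNIV :: 'a set)"
    and "proper_space TYPE('a)"
    and "geodesic_space TYPE('a)"
    and "busemann_concave TYPE('a)"
    and "is_line \<gamma>"
  shows "(\<forall>x. \<exists>\<eta>. is_line \<eta> \<and> parallel_line \<eta> \<gamma> \<and> x \<in> range \<eta> \<and>
            (\<forall>\<eta>'. is_line \<eta>' \<and> parallel_line \<eta>' \<gamma> \<and> x \<in> range \<eta>' \<longrightarrow>
               (\<exists>s. \<forall>t. \<eta>' t = \<eta> (t + s))))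
       \<and> (\<exists>(X' :: 'a metric) (D :: ('a \<times> real) metric).
            is_product_metric X' D \<and>
            bi_lipschitz_homeomorphic (euclidean_metric :: 'a metric) D)"
proof -
  interpret concave_space_with_line \<gamma>
    using assms by unfold_locales
  show ?thesis
    using parallel_line_exists_unique bi_lipschitz_product is_product_metric_prod_metric by blast
qed

end
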